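(* Let $n\geqslant 2$ and let $E\subset\mathbb{R}^n$ be a closed set with $\mathrm{Int}\,E\neq\varnothing$. If $E$ is weakly $1$-semiconvex (in the sense of closed sets), then the open set $\mathrm{Int}\,E$ is weakly $1$-semiconvex (in the sense of open sets).
   Context: $\mathbb{R}^n$ carries the Euclidean norm; $\mathrm{Int}\,E$ is the interior of $E$. A ray is a closed half-line $\{y+t\alpha: t\in[0,+\infty)\}$ with $y\in\mathbb{R}^n$ and $\|\alpha\|=1$. An open set $G\subset\mathbb{R}^n$ is called weakly $1$-semiconvex if for every point $x\in\partial G$ there exists a ray $L$ with $x\in L$ and $L\cap G=\varnothing$ (equivalently, a ray emanating from $x$ with this property). A set $A$ is approximated from the outside by a family of open sets $A_k$, $k=1,2,\ldots$, if $\overline{A_{k+1}}\subset A_k$ for all $k$ and $A=\bigcap_k A_k$. A closed set $E\subset\mathbb{R}^n$ is called weakly $1$-semiconvex if it can be approximated from the outside by a family of open weakly $1$-semiconvex sets. *)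

theory Defs
  imports "HOL-Analysis.Analysis"
begin

definition is_ray :: "'a::real_normed_vector set \<Rightarrow> bool" where
  "is_ray L \<longleftrightarrow> (\<exists>y \<alpha>. norm \<alpha> = 1 \<and> L = {y + t *\<^sub>R \<alpha> | t. 0 \<le> t})"

text \<open>The ray is only required to pass through the boundary point, not to start there.\<close>

definition weakly_1_semiconvex_open :: "'a::real_normed_vector set \<Rightarrow> bool" where
  "weakly_1_semiconvex_open G \<longleftrightarrow>
     open G \<and> (\<forall>x \<in> frontier G. \<exists>L. is_ray L \<and> x \<in> L \<and> L \<inter> G = {})"

text \<open>The approximating family is indexed from 0 instead of 1.\<close>

definition approximated_from_outside ::
    "'a::topological_space set \<Rightarrow> (nat \<Rightarrow> 'a set) \<Rightarrow> bool" where
  "approximated_from_outside E A \<longleftrightarrow>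
     (\<forall>k. open (A k)) \<and> (\<forall>k. closure (A (Suc k)) \<subseteq> A k) \<and> E = (\<Inter>k. A k)"

definition weakly_1_semiconvex_closed :: "'a::real_normed_vector set \<Rightarrow> bool" where
  "weakly_1_semiconvex_closed E \<longleftrightarrow>
     closed E \<and> (\<exists>A. approximated_from_outside E A \<and> (\<forall>k. weakly_1_semiconvex_open (A k)))"

end

theory Submission
  imports Defs
begin

text \<open>
  A boundary point \<open>x\<close> of \<open>interior E\<close> is a limit of points outside \<open>E\<close>. Each of them lies outside
  some \<open>A k\<close>, so the segment joining it to \<open>x\<close> meets the frontier of that \<open>A k\<close>, at a point where a
  ray avoiding \<open>A k\<close>, hence \<open>E\<close>, starts. As the unit sphere is compact, a subsequence of these rays
  converges to a ray from \<open>x\<close>, and it avoids the open set \<open>interior E\<close>.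
\<close>

lemma weakly_1_semiconvex_open_rayE:
  assumes "weakly_1_semiconvex_open G" and "x \<in> frontier G"
  obtains \<alpha> where "norm \<alpha> = 1" and "\<And>t. 0 \<le> t \<Longrightarrow> x + t *\<^sub>R \<alpha> \<notin> G"
proof -
  obtain L where L: "is_ray L" "x \<in> L" "L \<inter> G = {}"
    using assms unfolding weakly_1_semiconvex_open_def by blast
  obtain y \<alpha> where \<alpha>: "norm \<alpha> = 1" and Leq: "L = {y + t *\<^sub>R \<alpha> | t. 0 \<le> t}"
    using L(1) unfolding is_ray_def by blast
  obtain s where s: "0 \<le> s" "x = y + s *\<^sub>R \<alpha>"
    using L(2) Leq by blast
  have "x + t *\<^sub>R \<alpha> \<notin> G" if "0 \<le> t" for t
  proof -
    have "x + t *\<^sub>R \<alpha> = y + (s + t) *\<^sub>R \<alpha>"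
      using s(2) by (simp add: algebra_simps)
    then have "x + t *\<^sub>R \<alpha> \<in> L"
      using s(1) that unfolding Leq by auto
    then show ?thesis
      using L(3) by blast
  qed
  with \<alpha> show thesis by (rule that)
qed

lemma weakly_1_semiconvex_closed_ray_near:
  fixes E :: "'a::real_normed_vector set"
  assumes "weakly_1_semiconvex_closed E" and "x \<in> E" and "x \<notin> interior E" and "0 < e"
  obtains y \<alpha> where "dist x y < e" and "norm \<alpha> = 1" and "\<And>t. 0 \<le> t \<Longrightarrow> y + t *\<^sub>R \<alpha> \<notin> E"
proof -
  obtain A :: "nat \<Rightarrow> 'a set" where E: "E = (\<Inter>k. A k)" and A: "\<And>k. weakly_1_semiconvex_open (A k)"
    using assms(1) unfolding weakly_1_semiconvex_closed_def approximated_from_outside_def by blast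
  obtain z where z: "z \<in> ball x e" "z \<notin> E"
    using assms(3,4) unfolding mem_interior by blast
  obtain k where k: "z \<notin> A k"
    using z(2) E by blast
  have "x \<in> A k"
    using assms(2) E by blast
  then have "closed_segment x z \<inter> frontier (A k) \<noteq> {}"
    using k by (intro connected_Int_frontier) auto
  then obtain y where y: "y \<in> closed_segment x z" "y \<in> frontier (A k)"
    by blast
  have "closed_segment x z \<subseteq> ball x e"
    using z(1) assms(4) by (intro closed_segment_subset) auto
  then have "dist x y < e"
    using y(1) by auto
  moreover obtain \<alpha> where "norm \<alpha> = 1" and "\<And>t. 0 \<le> t \<Longrightarrow> y + t *\<^sub>R \<alpha> \<notin> A k"
    using weakly_1_semiconvex_open_rayE[OF A y(2)] by blast
  ultimately show thesis
    using that E by blast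
qed

lemma ray_avoiding_open_limit:
  fixes U :: "'a::euclidean_space set"
  assumes "open U" and "y \<longlonglongrightarrow> x" and "\<And>n. norm (\<alpha> n) = 1"
    and "\<And>n t. 0 \<le> t \<Longrightarrow> y n + t *\<^sub>R \<alpha> n \<notin> U"
  obtains \<beta> where "norm \<beta> = 1" and "\<And>t. 0 \<le> t \<Longrightarrow> x + t *\<^sub>R \<beta> \<notin> U"
proof -
  have "seq_compact (sphere (0::'a) 1)"
    by (simp add: compact_imp_seq_compact)
  moreover have "\<forall>n. \<alpha> n \<in> sphere 0 1"
    using assms(3) by simp
  ultimately obtain \<beta> r where \<beta>: "\<beta> \<in> sphere 0 1" and r: "strict_mono (r :: nat \<Rightarrow> nat)"
    and lim: "(\<alpha> \<circ> r) \<longlonglongrightarrow> \<beta>"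
    unfolding seq_compact_def by metis
  have "x + t *\<^sub>R \<beta> \<notin> U" if "0 \<le> t" for t
  proof -
    have lim': "(\<lambda>n. (y \<circ> r) n + t *\<^sub>R (\<alpha> \<circ> r) n) \<longlonglongrightarrow> x + t *\<^sub>R \<beta>"
      by (intro tendsto_intros LIMSEQ_subseq_LIMSEQ[OF assms(2) r] lim)
    have "x + t *\<^sub>R \<beta> \<in> - U"
      by (rule closed_sequentially[OF closed_Compl[OF assms(1)] _ lim'])
        (simp add: assms(4) that)
    then show ?thesis by simp
  qed
  with \<beta> show thesis
    by (intro that) auto
qed

theorem theorem3:
  fixes E :: "(real ^ 'n) set"
  assumes "CARD('n) \<ge> 2"
    and "closed E"
    and "interior E \<noteq> {}"
    and "weakly_1_semiconvex_closed E"
  shows "weakly_1_semiconvex_open (interior E)"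
  unfolding weakly_1_semiconvex_open_def
proof (intro conjI ballI)
  show "open (interior E)" by simp
next
  fix x assume x: "x \<in> frontier (interior E)"
  have "x \<in> E" "x \<notin> interior E"
    using x closure_minimal[OF interior_subset assms(2)] by (auto simp: frontier_def)
  then have ray_near: "\<exists>y \<alpha>. dist x y < e \<and> norm \<alpha> = 1 \<and> (\<forall>t\<ge>0. y + t *\<^sub>R \<alpha> \<notin> E)"
    if "0 < e" for e
    by (rule weakly_1_semiconvex_closed_ray_near[OF assms(4) _ _ that]) blast
  have "\<forall>n. \<exists>y \<alpha>. dist x y < inverse (real (Suc n)) \<and> norm \<alpha> = 1 \<and>
      (\<forall>t\<ge>0. y + t *\<^sub>R \<alpha> \<notin> E)"
    by (intro allI ray_near) simp
  then obtain y \<alpha> where y: "\<And>n. dist x (y n) < inverse (real (Suc n))"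
    and \<alpha>: "\<And>n. norm (\<alpha> n) = 1" and E: "\<And>n t. 0 \<le> t \<Longrightarrow> y n + t *\<^sub>R \<alpha> n \<notin> E"
    by metis
  have "(\<lambda>n. dist (y n) x) \<longlonglongrightarrow> 0"
    by (rule tendsto_sandwich[OF _ _ tendsto_const LIMSEQ_inverse_real_of_nat])
      (use y in \<open>auto simp: dist_commute intro!: always_eventually less_imp_le\<close>)
  then have "y \<longlonglongrightarrow> x"
    by (rule tendsto_dist_iff[THEN iffD2])
  then obtain \<beta> where \<beta>: "norm \<beta> = 1" "\<And>t. 0 \<le> t \<Longrightarrow> x + t *\<^sub>R \<beta> \<notin> interior E"
    by (rule ray_avoiding_open_limit[OF open_interior, of y x \<alpha> E]) (use \<alpha> E interior_subset[of E] in \<open>blast+\<close>)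
  have "x = x + 0 *\<^sub>R \<beta>" by simp
  then have "x \<in> {x + t *\<^sub>R \<beta> | t. 0 \<le> t}" by blast
  with \<beta> show "\<exists>L. is_ray L \<and> x \<in> L \<and> L \<inter> interior E = {}"
    by (intro exI[of _ "{x + t *\<^sub>R \<beta> | t. 0 \<le> t}"]) (auto simp: is_ray_def)
qed

end
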